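(* Let $r\ge1$ and let $a_1,\dots,a_r$ be nonzero complex numbers, and let $s$ be a nonnegative integer. For every integer $n\ge0$, $$D_n(x|a_1,\dots,a_r)=\sum_{m=0}^n\left(\sum_{i=0}^{n-m}\sum_{l=0}^{n-m-i}\binom{n}{i}\binom{n-i}{l}\mathfrak C_i^{(s)}S_1(n-i-l,m)D_l(a_1,\dots,a_r)\right)\mathfrak B_m^{(s)}(x),$$ $$\widehat D_n(x|a_1,\dots,a_r)=\sum_{m=0}^n\left(\sum_{i=0}^{n-m}\sum_{l=0}^{n-m-i}\binom{n}{i}\binom{n-i}{l}\mathfrak C_i^{(s)}S_1(n-i-l,m)\widehat D_l(a_1,\dots,a_r)\right)\mathfrak B_m^{(s)}(x).$$
   Context: For nonzero complex $a_1,\dots,a_r$, the Barnes-type Daehee polynomials of the first and second kind are defined by the formal power series identities $\prod_{j=1}^r\frac{\ln(1+t)}{(1+t)^{a_j}-1}(1+t)^x=\sum_{n\ge0}D_n(x|a_1,\dots,a_r)\frac{t^n}{n!}$ and $\prod_{j=1}^r\frac{(1+t)^{a_j}\ln(1+t)}{(1+t)^{a_j}-1}(1+t)^x=\sum_{n\ge0}\widehat D_n(x|a_1,\dots,a_r)\frac{t^n}{n!}$; the numbers are $D_n(a_1,\dots,a_r)=D_n(0|a_1,\dots,a_r)$, $\widehat D_n(a_1,\dots,a_r)=\widehat D_n(0|a_1,\dots,a_r)$. Bernoulli polynomials of order $s$: $\left(\frac{t}{e^t-1}\right)^se^{xt}=\sum_{n\ge0}\mathfrak B_n^{(s)}(x)\frac{t^n}{n!}$.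 Cauchy numbers of the first kind of order $s$: $\left(\frac{t}{\ln(1+t)}\right)^s=\sum_{n\ge0}\mathfrak C_n^{(s)}\frac{t^n}{n!}$. $S_1(n,m)$ are the signed Stirling numbers of the first kind: $x(x-1)\cdots(x-n+1)=\sum_{m=0}^nS_1(n,m)x^m$. *)

theory Defs
  imports Complex_Main "HOL-Computational_Algebra.Computational_Algebra"
begin

definition egf_coeff :: "complex fps \<Rightarrow> nat \<Rightarrow> complex" where
  "egf_coeff F n = fact n * fps_nth F n"

(* The series (1+t)^c is "fps_binomial c", ln(1+t) is "fps_ln 1", and e^(ct) is "fps_exp c".
   Numerators and denominators of the quotients below vanish at t = 0; for a nonzero exponent both
   have order exactly 1 in t, so the fps division is exact (see the lemmas at the end). *)

definition barnes_daehee1 :: "nat \<Rightarrow> (nat \<Rightarrow> complex) \<Rightarrow> nat \<Rightarrow> complex \<Rightarrow> complex" where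
  "barnes_daehee1 r a n x =
     egf_coeff ((\<Prod>j=1..r. fps_ln 1 / (fps_binomial (a j) - 1)) * fps_binomial x) n"

definition barnes_daehee2 :: "nat \<Rightarrow> (nat \<Rightarrow> complex) \<Rightarrow> nat \<Rightarrow> complex \<Rightarrow> complex" where
  "barnes_daehee2 r a n x =
     egf_coeff ((\<Prod>j=1..r. (fps_binomial (a j) * fps_ln 1) / (fps_binomial (a j) - 1))
                  * fps_binomial x) n"

definition barnes_daehee1_num :: "nat \<Rightarrow> (nat \<Rightarrow> complex) \<Rightarrow> nat \<Rightarrow> complex" where
  "barnes_daehee1_num r a n = barnes_daehee1 r a n 0"

definition barnes_daehee2_num :: "nat \<Rightarrow> (nat \<Rightarrow> complex) \<Rightarrow> nat \<Rightarrow> complex" where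
  "barnes_daehee2_num r a n = barnes_daehee2 r a n 0"

definition bernoulli_poly_order :: "nat \<Rightarrow> nat \<Rightarrow> complex \<Rightarrow> complex" where
  "bernoulli_poly_order s n x = egf_coeff ((fps_X / (fps_exp 1 - 1)) ^ s * fps_exp x) n"

definition cauchy_num_order :: "nat \<Rightarrow> nat \<Rightarrow> complex" where
  "cauchy_num_order s n = egf_coeff ((fps_X / fps_ln 1) ^ s) n"

definition signed_stirling1 :: "nat \<Rightarrow> nat \<Rightarrow> int" where
  "signed_stirling1 n m = coeff (\<Prod>i<n. [:- of_nat i, 1:]) m"

lemma signed_stirling1_falling:
  "(\<Prod>i<n. x - of_nat i) = (\<Sum>m=0..n. of_int (signed_stirling1 n m) * x ^ m)"
  for x :: complex
proof -
  let ?p = "(\<Prod>i<n. [:- of_nat i, 1:]) :: int poly"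
  have deg: "degree ?p = n"
    by (subst degree_prod_eq_sum_degree) auto
  have "poly (map_poly of_int ?p) x = (\<Sum>m\<le>degree ?p. of_int (coeff ?p m) * x ^ m)"
    by (simp add: poly_altdef coeff_map_poly degree_map_poly)
  moreover have "poly (map_poly of_int ?p) x = (\<Prod>i<n. x - of_nat i)"
  proof (induction n)
    case (Suc n)
    have "poly (map_poly of_int (p * q)) x
            = poly (map_poly of_int p) x * poly (map_poly of_int q) x" for p q :: "int poly"
    proof -
      have "map_poly of_int (p * q) = map_poly of_int p * (map_poly of_int q :: complex poly)"
        by (rule poly_eqI) (simp add: coeff_map_poly coeff_mult)
      then show ?thesis by simp
    qed
    then show ?case
      by (simp only: prod.lessThan_Suc Suc) (simp add: map_poly_pCons)
  qed simp
  ultimately show ?thesis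
    by (simp add: deg signed_stirling1_def atMost_atLeast0)
qed

lemma subdegree_binomial_minus_1:
  "a \<noteq> 0 \<Longrightarrow> subdegree (fps_binomial a - 1 :: complex fps) = 1"
  by (rule subdegreeI) auto

lemma subdegree_fps_ln: "subdegree (fps_ln 1 :: complex fps) = 1"
  by (rule subdegreeI) (auto simp: fps_ln_nth)

lemma subdegree_exp_minus_1: "subdegree (fps_exp 1 - 1 :: complex fps) = 1"
  by (rule subdegreeI) auto

lemma fps_exact_division:
  fixes f g :: "complex fps"
  assumes "g \<noteq> 0" "subdegree g \<le> subdegree f"
  shows "f / g * g = f"
proof (cases "f = 0")
  case False
  with assms have "g dvd f" by (simp add: fps_dvd_iff)
  then show ?thesis by simp
qed simp

lemma quotients_exact:
  assumes "a \<noteq> 0"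
  shows "fps_ln 1 / (fps_binomial a - 1) * (fps_binomial a - 1) = (fps_ln 1 :: complex fps)"
    and "(fps_binomial a * fps_ln 1) / (fps_binomial a - 1) * (fps_binomial a - 1)
           = (fps_binomial a * fps_ln 1 :: complex fps)"
    and "fps_X / (fps_exp 1 - 1) * (fps_exp 1 - 1) = (fps_X :: complex fps)"
    and "fps_X / fps_ln 1 * fps_ln 1 = (fps_X :: complex fps)"
proof -
  have nz: "fps_binomial a - 1 \<noteq> (0 :: complex fps)" "fps_exp 1 - 1 \<noteq> (0 :: complex fps)"
    "fps_ln 1 \<noteq> (0 :: complex fps)" "fps_binomial a \<noteq> (0 :: complex fps)"
    using subdegree_binomial_minus_1[OF assms] subdegree_exp_minus_1 subdegree_fps_ln
    by (auto simp: fps_eq_iff[of "fps_binomial a" 0] intro!: exI[of _ 0])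
  note sd = subdegree_binomial_minus_1[OF assms] subdegree_exp_minus_1 subdegree_fps_ln
  show "fps_ln 1 / (fps_binomial a - 1) * (fps_binomial a - 1) = (fps_ln 1 :: complex fps)"
    using nz sd by (intro fps_exact_division) auto
  show "(fps_binomial a * fps_ln 1) / (fps_binomial a - 1) * (fps_binomial a - 1)
           = (fps_binomial a * fps_ln 1 :: complex fps)"
    using nz sd by (intro fps_exact_division) auto
  show "fps_X / (fps_exp 1 - 1) * (fps_exp 1 - 1) = (fps_X :: complex fps)"
    using nz sd by (intro fps_exact_division) auto
  show "fps_X / fps_ln 1 * fps_ln 1 = (fps_X :: complex fps)"
    using nz sd by (intro fps_exact_division) auto
qed

end

(* Put A = (t / ln(1+t))^s and G(u) = (u / (e^u - 1))^s e^(xu).  Substituting u = ln(1+t) gives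
   A * G(ln(1+t)) = (1+t)^x, so a series of the form F * (1+t)^x equals A * F * G(ln(1+t)).  Comparing
   coefficients yields the expansion, because the Stirling numbers S_1(., m) are the coefficients of
   ln(1+t)^m / m!. *)
theory Submission
  imports Defs
begin

text \<open>Both sides solve y' = x y / (1+t) with y(0) = 1, and this initial value problem has only
  one formal solution.\<close>

lemma fps_exp_compose_ln: "fps_exp x oo fps_ln 1 = fps_binomial (x :: complex)"
proof -
  have "fps_deriv (fps_exp x oo fps_ln 1) = fps_const x * (fps_exp x oo fps_ln 1) / (1 + fps_X)"
    by (simp add: fps_compose_deriv fps_ln_deriv fps_divide_unit fps_const_mult_apply_left mult.assoc)
  then show ?thesis
    by (simp flip: fps_binomial_ODE_unique')
qed

lemma fps_ln_power_nth:
  "fact k * fps_nth (fps_ln 1 ^ m) k = fact m * (of_int (signed_stirling1 k m) :: complex)"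
proof (cases "m \<le> k")
  case True
  (* Both sides arise as coefficients of x^m in fact k * (x gchoose k), a polynomial in x. *)
  have "\<forall>x::complex. (\<Sum>i\<le>k. fact k / fact i * fps_nth (fps_ln 1 ^ i) k * x ^ i)
      = (\<Sum>i\<le>k. of_int (signed_stirling1 k i) * x ^ i)"
  proof
    fix x :: complex
    have "(\<Sum>i\<le>k. fact k / fact i * fps_nth (fps_ln 1 ^ i) k * x ^ i)
        = fact k * fps_nth (fps_exp x oo fps_ln 1) k"
      by (simp add: fps_compose_nth sum_distrib_left atMost_atLeast0 mult_ac)
    also have "\<dots> = (\<Prod>i<k. x - of_nat i)"
      by (simp add: fps_exp_compose_ln gbinomial_mult_fact lessThan_atLeast0)
    also have "\<dots> = (\<Sum>i\<le>k. of_int (signed_stirling1 k i) * x ^ i)"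
      by (simp add: signed_stirling1_falling atMost_atLeast0)
    finally show "(\<Sum>i\<le>k. fact k / fact i * fps_nth (fps_ln 1 ^ i) k * x ^ i)
        = (\<Sum>i\<le>k. of_int (signed_stirling1 k i) * x ^ i)" .
  qed
  \<comment> \<open>Two polynomials in x that agree at every complex number have equal coefficients;
    \<open>m \<le> k\<close> puts m in the range of summation.\<close>
  then have "fact k / fact m * fps_nth (fps_ln 1 ^ m) k = (of_int (signed_stirling1 k m) :: complex)"
    unfolding polyfun_eq_coeffs using True by blast
  then show ?thesis
    by (simp add: field_simps)
next
  case False
  \<comment> \<open>For m > k both sides vanish: a product of k linear factors has no x^m term, and
    ln(1+t)^m has order m in t.\<close>
  have "degree (\<Prod>i<k. [:- of_nat i, 1:] :: int poly) = k"
    by (subst degree_prod_eq_sum_degree) auto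
  with False have "signed_stirling1 k m = 0"
    by (simp add: signed_stirling1_def coeff_eq_0)
  with False show ?thesis
    by (simp add: startsby_zero_power_prefix)
qed

lemma egf_coeff_compose_ln:
  "egf_coeff (G oo fps_ln 1) k = (\<Sum>m=0..k. of_int (signed_stirling1 k m) * egf_coeff G m)"
proof -
  have "egf_coeff (G oo fps_ln 1) k = (\<Sum>m=0..k. fps_nth G m * (fact k * fps_nth (fps_ln 1 ^ m) k))"
    by (simp add: egf_coeff_def fps_compose_nth sum_distrib_left mult_ac)
  then show ?thesis
    by (simp add: fps_ln_power_nth egf_coeff_def mult_ac)
qed

lemma egf_coeff_mult:
  "egf_coeff (F * G) n = (\<Sum>i=0..n. of_nat (n choose i) * egf_coeff F i * egf_coeff G (n - i))"
  unfolding egf_coeff_def fps_mult_nth sum_distrib_left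
  by (rule sum.cong) (simp_all add: binomial_fact)

text \<open>Substituting u = ln(1+t) turns u/(e^u - 1) into ln(1+t)/t, the reciprocal of
  t/ln(1+t).\<close>

lemma fps_X_over_ln_times_compose:
  "(fps_X / fps_ln 1) * ((fps_X / (fps_exp 1 - 1)) oo fps_ln 1) = (1 :: complex fps)"
proof -
  let ?L = "fps_ln 1 :: complex fps"
  let ?A = "fps_X / ?L" and ?B = "(fps_X / (fps_exp 1 - 1) :: complex fps) oo ?L"
  \<comment> \<open>The substitution is made in the product form of the exact division, so
    composition never has to pass through a quotient; the spare factor t is cancelled at the
    end.\<close>
  have "(fps_X / (fps_exp 1 - 1) * (fps_exp 1 - 1) :: complex fps) oo ?L = fps_X oo ?L"
    by (simp only: quotients_exact(3)[OF one_neq_zero])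
  then have "?B * fps_X = ?L"
    by (simp add: fps_compose_mult_distrib fps_compose_sub_distrib fps_exp_compose_ln fps_binomial_1)
  then have "?A * ?B * fps_X = ?A * ?L"
    by (simp add: mult.assoc)
  also have "\<dots> = 1 * fps_X"
    by (simp only: quotients_exact(4)[OF one_neq_zero] mult_1)
  finally show ?thesis
    by simp
qed

lemma fps_binomial_factorization:
  fixes x :: complex
  shows "fps_binomial x
     = (fps_X / fps_ln 1) ^ s * (((fps_X / (fps_exp 1 - 1)) ^ s * fps_exp x) oo fps_ln 1)"
proof -
  have "((fps_X / (fps_exp 1 - 1)) ^ s * fps_exp x) oo fps_ln 1
      = ((fps_X / (fps_exp 1 - 1)) oo fps_ln 1) ^ s * fps_binomial x"
    by (simp add: fps_compose_mult_distrib fps_compose_power fps_exp_compose_ln)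
  then show ?thesis
    by (simp add: fps_X_over_ln_times_compose flip: mult.assoc power_mult_distrib)
qed

text \<open>Both sides sum over the simplex i + l + m \<le> n; the bijection only permutes the
  coordinates.\<close>

lemma sum_simplex_swap:
  fixes g :: "nat \<Rightarrow> nat \<Rightarrow> nat \<Rightarrow> 'a::comm_monoid_add"
  shows "(\<Sum>i=0..n. \<Sum>l=0..n-i. \<Sum>m=0..n-i-l. g i l m)
       = (\<Sum>m=0..n. \<Sum>i=0..n-m. \<Sum>l=0..n-m-i. g i l m)"
  unfolding sum.Sigma[OF finite_atLeastAtMost ballI[OF finite_atLeastAtMost]]
  by (simp add: sum.Sigma split_def)
    (rule sum.reindex_bij_witness[where i = "\<lambda>(m, i, l). (i, l, m)" and j = "\<lambda>(i, l, m). (m, i, l)"]; force)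

text \<open>An arbitrary F lets one identity serve both kinds of Daehee polynomials.\<close>

lemma egf_coeff_mult_binomial:
  "egf_coeff (F * fps_binomial x) n =
     (\<Sum>m=0..n. (\<Sum>i=0..n-m. \<Sum>l=0..n-m-i.
        of_nat (n choose i) * of_nat ((n - i) choose l) * cauchy_num_order s i
          * of_int (signed_stirling1 (n - i - l) m) * egf_coeff F l)
        * bernoulli_poly_order s m x)"
proof -
  define A :: "complex fps" where "A = (fps_X / fps_ln 1) ^ s"
  define G where "G = (fps_X / (fps_exp 1 - 1)) ^ s * fps_exp x"
  \<comment> \<open>This order of the factors makes two binomial convolutions give index i to A, l
    to F and n-i-l to the composed series.\<close>
  have "F * fps_binomial x = A * (F * (G oo fps_ln 1))"
    unfolding A_def G_def by (subst fps_binomial_factorization[of x s]) (simp only: mult.left_commute)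
  moreover have "egf_coeff (A * (F * (G oo fps_ln 1))) n =
      (\<Sum>i=0..n. \<Sum>l=0..n-i. \<Sum>m=0..n-i-l.
        of_nat (n choose i) * of_nat ((n - i) choose l) * cauchy_num_order s i
          * of_int (signed_stirling1 (n - i - l) m) * egf_coeff F l * bernoulli_poly_order s m x)"
    unfolding cauchy_num_order_def bernoulli_poly_order_def A_def[symmetric] G_def[symmetric]
    by (simp add: egf_coeff_mult egf_coeff_compose_ln sum_distrib_left mult_ac)
  ultimately show ?thesis
    by (simp only: sum_distrib_right) (rule sum_simplex_swap)
qed

theorem theorem10:
  fixes r s n :: nat and a :: "nat \<Rightarrow> complex" and x :: complex
  assumes "r \<ge> 1"
    and "\<And>j. j \<in> {1..r} \<Longrightarrow> a j \<noteq> 0"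
  shows "barnes_daehee1 r a n x =
           (\<Sum>m=0..n. (\<Sum>i=0..n-m. \<Sum>l=0..n-m-i.
              of_nat (n choose i) * of_nat ((n - i) choose l) * cauchy_num_order s i
                * of_int (signed_stirling1 (n - i - l) m) * barnes_daehee1_num r a l)
              * bernoulli_poly_order s m x)
       \<and> barnes_daehee2 r a n x =
           (\<Sum>m=0..n. (\<Sum>i=0..n-m. \<Sum>l=0..n-m-i.
              of_nat (n choose i) * of_nat ((n - i) choose l) * cauchy_num_order s i
                * of_int (signed_stirling1 (n - i - l) m) * barnes_daehee2_num r a l)
              * bernoulli_poly_order s m x)"
  \<comment> \<open>F is the product over j. At x = 0 the factor (1+t)^x is 1, so the Daehee numbers
    are exactly the values \<open>egf_coeff F l\<close>.\<close>
  unfolding barnes_daehee1_num_def barnes_daehee2_num_def barnes_daehee1_def barnes_daehee2_def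
    egf_coeff_mult_binomial[of _ x n s] fps_binomial_0 mult_1_right
  by simp

end
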